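(* Let $G$ be a finite group and let $G'=[G,G]$ be its commutator subgroup. Then $$\mathsf D(G)\leq \mathsf d(G)+2|G'|-1,$$ with equality if and only if $G$ is abelian.
   Context: Let $G$ be a finite group written multiplicatively with identity $1$. A sequence over $G$ is a finite, unordered list of elements of $G$ with repetition allowed (a finite multiset); its length $|S|$ is its number of terms counted with multiplicity, and a subsequence is a sub-multiset. A sequence is product-one if its terms can be ordered so that their product equals $1$. A minimal product-one sequence (atom) is a nontrivial (nonempty) product-one sequence that cannot be partitioned into two nontrivial product-one subsequences. The small Davenport constant $\mathsf d(G)$ is the maximal integer $\ell$ such that there is a sequence over $G$ of length $\ell$ having no nontrivial product-one subsequence. The large Davenport constant $\mathsf D(G)$ is the maximal length of a minimal product-one sequence over $G$. *)

theory Defs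
  imports "HOL-Algebra.Generated_Groups" "HOL-Library.Multiset"
begin

definition list_product :: "('a, 'b) monoid_scheme \<Rightarrow> 'a list \<Rightarrow> 'a" where
  "list_product G xs = foldr (\<otimes>\<^bsub>G\<^esub>) xs \<one>\<^bsub>G\<^esub>"

definition sequence_over :: "('a, 'b) monoid_scheme \<Rightarrow> 'a multiset \<Rightarrow> bool" where
  "sequence_over G S \<longleftrightarrow> set_mset S \<subseteq> carrier G"

definition product_one :: "('a, 'b) monoid_scheme \<Rightarrow> 'a multiset \<Rightarrow> bool" where
  "product_one G S \<longleftrightarrow>
     sequence_over G S \<and> (\<exists>xs. mset xs = S \<and> list_product G xs = \<one>\<^bsub>G\<^esub>)"

definition product_one_free :: "('a, 'b) monoid_scheme \<Rightarrow> 'a multiset \<Rightarrow> bool" where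
  "product_one_free G S \<longleftrightarrow>
     sequence_over G S \<and> \<not> (\<exists>T. T \<subseteq># S \<and> T \<noteq> {#} \<and> product_one G T)"

definition minimal_product_one :: "('a, 'b) monoid_scheme \<Rightarrow> 'a multiset \<Rightarrow> bool" where
  "minimal_product_one G S \<longleftrightarrow>
     S \<noteq> {#} \<and> product_one G S \<and>
     \<not> (\<exists>A B. S = A + B \<and> A \<noteq> {#} \<and> B \<noteq> {#} \<and> product_one G A \<and> product_one G B)"

text \<open>
  For a finite group, the sets of lengths below are finite and nonempty (proved at the
  end of this theory), so both maxima are attained.
\<close>

definition small_davenport :: "('a, 'b) monoid_scheme \<Rightarrow> nat" where
  "small_davenport G = Max {size S | S. product_one_free G S}"

definition large_davenport :: "('a, 'b) monoid_scheme \<Rightarrow> nat" where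
  "large_davenport G = Max {size S | S. minimal_product_one G S}"

context group
begin

lemma list_product_closed:
  "set xs \<subseteq> carrier G \<Longrightarrow> list_product G xs \<in> carrier G"
  by (induction xs) (auto simp: list_product_def)

lemma list_product_append:
  "set xs \<subseteq> carrier G \<Longrightarrow> set ys \<subseteq> carrier G \<Longrightarrow>
   list_product G (xs @ ys) = list_product G xs \<otimes> list_product G ys"
proof (induction xs)
  case Nil
  then show ?case using list_product_closed[of ys] by (simp add: list_product_def)
next
  case (Cons x xs)
  then show ?case
    using list_product_closed[of ys] list_product_closed[of xs]
    by (simp add: list_product_def m_assoc)
qed

lemma product_one_segment:
  assumes fin: "finite (carrier G)" and xs: "set xs \<subseteq> carrier G"
    and len: "card (carrier G) \<le> length xs"
  obtains p q r where "xs = p @ q @ r" "q \<noteq> []" "list_product G q = \<one>"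
proof -
  let ?f = "\<lambda>i. list_product G (take i xs)"
  have sub: "set (take i xs) \<subseteq> carrier G" for i
    using xs set_take_subset by fast
  have "?f ` {..length xs} \<subseteq> carrier G" using list_product_closed[OF sub] by auto
  then have "card (?f ` {..length xs}) \<le> card (carrier G)" using fin card_mono by blast
  then have "\<not> inj_on ?f {..length xs}" using len card_image by fastforce
  then obtain i j where ij: "i < j" "j \<le> length xs" "?f i = ?f j"
    unfolding inj_on_def by (metis atMost_iff nat_neq_iff)
  let ?q = "take (j - i) (drop i xs)"
  have q: "set ?q \<subseteq> carrier G" using xs by (meson set_take_subset set_drop_subset subset_trans)
  have tj: "take j xs = take i xs @ ?q"
    using ij(1) take_add[of i "j - i" xs] by simp
  have "?f i \<otimes> list_product G ?q = ?f i \<otimes> \<one>"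
    using ij(3) list_product_append[OF sub q] list_product_closed[OF sub] tj by simp
  then have "list_product G ?q = \<one>"
    using list_product_closed[OF sub] list_product_closed[OF q] by (metis Units_eq Units_l_cancel one_closed)
  moreover have "?q \<noteq> []" using ij by auto
  moreover have "xs = take i xs @ ?q @ drop j xs"
    using tj by (metis append_assoc append_take_drop_id)
  ultimately show thesis using that by blast
qed

lemma product_one_free_size:
  assumes "finite (carrier G)" "product_one_free G S"
  shows "size S \<le> card (carrier G)"
proof (rule ccontr)
  assume c: "\<not> size S \<le> card (carrier G)"
  obtain xs where S: "S = mset xs" by (metis ex_mset)
  have xs: "set xs \<subseteq> carrier G"
    using assms(2) by (simp add: product_one_free_def sequence_over_def S)
  obtain p q r where pqr: "xs = p @ q @ r" "q \<noteq> []" "list_product G q = \<one>"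
    using product_one_segment[OF assms(1) xs] c S by auto
  then have "product_one G (mset q)"
    using xs by (auto simp: product_one_def sequence_over_def)
  moreover have "mset q \<subseteq># S" by (simp add: S pqr(1))
  ultimately show False
    using assms(2) pqr(2) by (auto simp: product_one_free_def)
qed

lemma minimal_product_one_size:
  assumes "finite (carrier G)" "minimal_product_one G S"
  shows "size S \<le> card (carrier G)"
proof (rule ccontr)
  assume c: "\<not> size S \<le> card (carrier G)"
  obtain ys where S: "S = mset ys" and one: "list_product G ys = \<one>"
    using assms(2) by (auto simp: minimal_product_one_def product_one_def)
  have ys: "set ys \<subseteq> carrier G"
    using assms(2) by (auto simp: minimal_product_one_def product_one_def sequence_over_def S)
  obtain x xs where x: "ys = x # xs" using c S by (cases ys) auto
  obtain p q r where pqr: "xs = p @ q @ r" "q \<noteq> []" "list_product G q = \<one>"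
    using product_one_segment[OF assms(1), of xs] c S ys x by auto
  have car: "set (x # p) \<subseteq> carrier G" "set q \<subseteq> carrier G" "set r \<subseteq> carrier G"
    using ys x pqr by auto
  have "list_product G ((x # p) @ r) = list_product G ((x # p) @ (q @ r))"
    using car pqr(3) list_product_closed[OF car(3)]
      list_product_append[OF car(1) car(3)] list_product_append[OF car(2) car(3)]
      list_product_append[OF car(1), of "q @ r"] by simp
  then have "list_product G ((x # p) @ r) = \<one>" using one x pqr(1) by simp
  then have "product_one G (mset ((x # p) @ r))"
    using car unfolding product_one_def sequence_over_def by (auto intro!: exI[of _ "x # p @ r"])
  moreover have "product_one G (mset q)"
    using car pqr(3) by (auto simp: product_one_def sequence_over_def)
  moreover have "S = mset ((x # p) @ r) + mset q" by (simp add: S x pqr(1))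
  ultimately show False
    using assms(2) pqr(2) unfolding minimal_product_one_def by fastforce
qed

lemma product_one_free_empty: "product_one_free G {#}"
  by (simp add: product_one_free_def sequence_over_def)

lemma minimal_product_one_single: "minimal_product_one G {#\<one>#}"
proof -
  have "product_one G {#\<one>#}"
    by (auto simp: product_one_def sequence_over_def list_product_def intro!: exI[of _ "[\<one>]"])
  then show ?thesis
    by (auto simp: minimal_product_one_def single_is_union)
qed

lemma davenport_well_defined:
  assumes "finite (carrier G)"
  shows "finite {size S | S. product_one_free G S}" "{size S | S. product_one_free G S} \<noteq> {}"
    and "finite {size S | S. minimal_product_one G S}" "{size S | S. minimal_product_one G S} \<noteq> {}"
proof -
  show "finite {size S | S. product_one_free G S}"
    by (rule finite_subset[of _ "{..card (carrier G)}"]) (use product_one_free_size[OF assms] in auto)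
  show "finite {size S | S. minimal_product_one G S}"
    by (rule finite_subset[of _ "{..card (carrier G)}"]) (use minimal_product_one_size[OF assms] in auto)
qed (use product_one_free_empty minimal_product_one_single in blast)+

end

end

theory Submission
  imports Defs
begin

text \<open>
  Let \<open>\<pi>(T)\<close> be the set of products of all orderings of \<open>T\<close>; it lies in one coset of \<open>G'\<close>, so
  \<open>|\<pi>(T)| \<le> |G'|\<close>. Given an atom \<open>S\<close>, choose a product-one ordering of \<open>S\<close> with a prefix \<open>T\<close>
  such that \<open>|T| \<le> 2|\<pi>(T)| - 2\<close> and \<open>|T|\<close> is maximal, and let \<open>R\<close> be the remaining terms. By maximality,
  appending one or two terms to the prefix does not enlarge \<open>\<pi>(T)\<close>. Hence
  \<open>\<pi>(T)ab = \<pi>(T)ba\<close> for the first two terms \<open>a, b\<close> of \<open>R\<close>, and \<open>a\<pi>(T) = \<pi>(T)a\<close> for its last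
  term \<open>a\<close>, which moves to the front by conjugation. So \<open>1 \<in> \<pi>(T)r\<close> survives swapping the first two terms
  and rotating, that is, it holds for the product \<open>r\<close> of any ordering of \<open>R\<close>. If \<open>|R| > d(G)\<close>, a
  product-one subsequence \<open>W\<close> of \<open>R\<close> can be ordered first and then dropped, so \<open>S\<close> without \<open>W\<close> is
  again product-one. Therefore \<open>|S| \<le> d(G) + max 1 (2|G'| - 2)\<close>.
\<close>

text \<open>The transposition of the first two positions and a full cycle generate the symmetric
  group: rotating brings any adjacent pair to the front, where it can be swapped, and then back. One
  direction of rotation suffices since its iterates give all rotations.\<close>

lemma perm_closed_by_swap_rotate:
  assumes swap: "\<And>a b xs. P (a # b # xs) \<Longrightarrow> P (b # a # xs)"
    and rot: "\<And>a xs. P (xs @ [a]) \<Longrightarrow> P (a # xs)"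
    and "P xs" "mset xs = mset ys"
  shows "P ys"
proof -
  have rotate: "P (ys @ xs)" if "P (xs @ ys)" for xs ys
    using that
  proof (induction ys arbitrary: xs rule: rev_induct)
    case (snoc y ys)
    then show ?case using rot[of "xs @ ys" y] snoc.IH[of "y # xs"] by simp
  qed simp
  have swap_inside: "P (p @ b # a # q)" if "P (p @ a # b # q)" for p a b q
    using rotate[of p "a # b # q"] swap[of a b "q @ p"] rotate[of "b # a # q" p] that by simp
  have move: "P (p @ x # q @ r)" if "P (p @ q @ x # r)" for p q x r
    using that
  proof (induction q arbitrary: r rule: rev_induct)
    case (snoc y q)
    then have "P (p @ q @ x # y # r)" using swap_inside[of "p @ q" y x r] by simp
    then show ?case using snoc.IH[of "y # r"] by simp
  qed simp
  \<comment> \<open>The prefix \<open>p\<close> holds the entries already in place; it is needed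
    because \<open>P\<close> speaks of the whole list and says nothing about tails.\<close>
  have "P (p @ ys)" if "P (p @ xs)" "mset xs = mset ys" for p
    using that
  proof (induction ys arbitrary: p xs)
    case (Cons y ys)
    then have "y \<in> set xs" by (metis list.set_intros(1) set_mset_mset)
    then obtain q r where xs: "xs = q @ y # r" by (meson split_list)
    have "P ((p @ [y]) @ (q @ r))" using move[of p q y r] Cons.prems xs by simp
    moreover have "mset (q @ r) = mset ys" using Cons.prems(2) xs by simp
    ultimately show ?case using Cons.IH[of "p @ [y]" "q @ r"] by simp
  qed simp
  from this[of "[]"] show ?thesis using assms(3,4) by simp
qed

section \<open>Product sets of sequences\<close>

definition products :: "('a, 'b) monoid_scheme \<Rightarrow> 'a multiset \<Rightarrow> 'a set" where
  "products G T = {list_product G xs | xs. mset xs = T}"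

context group
begin

lemma list_product_Nil [simp]: "list_product G [] = \<one>"
  by (simp add: list_product_def)

lemma list_product_Cons [simp]: "list_product G (x # xs) = x \<otimes> list_product G xs"
  by (simp add: list_product_def)

lemma products_append:
  assumes "sequence_over G A" "sequence_over G B" "x \<in> products G A" "y \<in> products G B"
  shows "x \<otimes> y \<in> products G (A + B)"
proof -
  obtain xs ys where *: "mset xs = A" "mset ys = B" "x = list_product G xs" "y = list_product G ys"
    using assms(3,4) by (auto simp: products_def)
  then have "set xs \<subseteq> carrier G" "set ys \<subseteq> carrier G"
    using assms(1,2) by (auto simp: sequence_over_def)
  then show ?thesis
    using * list_product_append[of xs ys] by (auto simp: products_def intro!: exI[of _ "xs @ ys"])
qed

lemma products_closed: "sequence_over G T \<Longrightarrow> products G T \<subseteq> carrier G"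
  using list_product_closed by (auto simp: products_def sequence_over_def)

lemma products_single: "x \<in> carrier G \<Longrightarrow> products G {#x#} = {x}"
  by (auto simp: products_def mset_single_iff_right intro!: exI[of _ "[x]"])

lemma product_one_iff_products: "product_one G S \<longleftrightarrow> sequence_over G S \<and> \<one> \<in> products G S"
  unfolding product_one_def products_def mem_Collect_eq by (metis (no_types))

section \<open>Reordering and cosets of the commutator subgroup\<close>

lemma derived_rcos_commute:
  assumes "x \<in> carrier G" "y \<in> carrier G"
  shows "derived G (carrier G) #> (x \<otimes> y) = derived G (carrier G) #> (y \<otimes> x)"
proof -
  let ?H = "derived G (carrier G)"
  have H: "subgroup ?H G" using derived_is_subgroup[of "carrier G"] by simp
  have "x \<otimes> y \<otimes> inv x \<otimes> inv y \<in> ?H"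
    unfolding derived_def using assms by (intro generate.incl) auto
  moreover have "x \<otimes> y = (x \<otimes> y \<otimes> inv x \<otimes> inv y) \<otimes> (y \<otimes> x)"
    using assms m_assoc[of "inv y" y x, symmetric] by (simp add: m_assoc)
  ultimately have "x \<otimes> y \<in> ?H #> (y \<otimes> x)"
    unfolding r_coset_def by blast
  then show ?thesis using repr_independence[of "x \<otimes> y" ?H "y \<otimes> x"] H assms by simp
qed

text \<open>The quotient by the commutator subgroup is commutative, so the head \<open>x\<close>,
  wherever it occurs in \<open>ys\<close>, can be pulled past the entries \<open>p\<close> before
  it.\<close>

lemma derived_rcos_list_product:
  assumes "mset xs = mset ys" "set xs \<subseteq> carrier G"
  shows "derived G (carrier G) #> list_product G xs = derived G (carrier G) #> list_product G ys"
  using assms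
proof (induction xs arbitrary: ys)
  case (Cons x xs)
  let ?H = "derived G (carrier G)"
  interpret H: normal ?H G using derived_self_is_normal .
  have "x \<in> set ys" by (metis Cons.prems(1) list.set_intros(1) set_mset_mset)
  then obtain p q where ys: "ys = p @ x # q" by (meson split_list)
  have "set ys = set (x # xs)" using Cons.prems(1) mset_eq_setD by metis
  then have c: "set p \<subseteq> carrier G" "set q \<subseteq> carrier G" "x \<in> carrier G" "set xs \<subseteq> carrier G"
    using ys Cons.prems(2) by auto
  have IH: "?H #> list_product G xs = ?H #> list_product G (p @ q)"
    using Cons.IH[of "p @ q"] Cons.prems(1) c ys by simp
  let ?p = "list_product G p" and ?q = "list_product G q" and ?x = "list_product G xs"
  have cl: "?p \<in> carrier G" "?q \<in> carrier G" "?x \<in> carrier G"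
    using c list_product_closed by auto
  have mul: "?H #> (a \<otimes> b) = (?H #> a) <#> (?H #> b)" if "a \<in> carrier G" "b \<in> carrier G" for a b
    using H.rcos_sum that by simp
  have "?H #> list_product G (x # xs) = ?H #> (x \<otimes> (?p \<otimes> ?q))"
    using IH c cl mul list_product_append[of p q] by simp
  also have "\<dots> = ?H #> ((x \<otimes> ?p) \<otimes> ?q)" using c cl by (simp add: m_assoc)
  also have "\<dots> = ?H #> ((?p \<otimes> x) \<otimes> ?q)"
    using mul[of "x \<otimes> ?p" ?q] mul[of "?p \<otimes> x" ?q] derived_rcos_commute[of x ?p] c cl by simp
  also have "\<dots> = ?H #> list_product G ys"
    using ys c cl list_product_append[of p "x # q"] by (simp add: m_assoc)
  finally show ?case .
qed simp

lemma card_products_le_derived: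
  assumes fin: "finite (carrier G)" and T: "sequence_over G T"
  shows "card (products G T) \<le> card (derived G (carrier G))"
proof -
  let ?H = "derived G (carrier G)"
  have H: "subgroup ?H G" using derived_is_subgroup[of "carrier G"] by simp
  obtain ts where ts: "mset ts = T" by (metis ex_mset)
  have c: "set ts \<subseteq> carrier G" using T ts by (auto simp: sequence_over_def)
  have "products G T \<subseteq> ?H #> list_product G ts"
  proof
    fix x assume "x \<in> products G T"
    then obtain xs where xs: "mset xs = T" "x = list_product G xs" by (auto simp: products_def)
    have "set xs \<subseteq> carrier G" using T xs by (auto simp: sequence_over_def)
    then show "x \<in> ?H #> list_product G ts"
      using derived_rcos_list_product[of ts xs] rcos_self[OF _ H, of x] list_product_closed xs ts c
      by simp
  qed
  moreover have "finite (?H #> list_product G ts)"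
    using fin r_coset_subset_G[of ?H "list_product G ts"] list_product_closed[OF c]
      subgroup.subset[OF H] finite_subset by blast
  moreover have "card (?H #> list_product G ts) = card ?H"
    using card_rcosets_equal[of "?H #> list_product G ts" ?H] subgroup.subset[OF H]
      rcosetsI list_product_closed[OF c] by simp
  ultimately show ?thesis using card_mono by fastforce
qed

section \<open>A prefix after which the order of the remaining terms is irrelevant\<close>

lemma products_translate:
  assumes fin: "finite (carrier G)" and T: "sequence_over G T" and "sequence_over G U"
    and u: "u \<in> products G U"
    and card: "card (products G (T + U)) \<le> card (products G T)"
  shows "products G (T + U) = (\<lambda>t. t \<otimes> u) ` products G T"
proof -
  have uc: "u \<in> carrier G" using u products_closed assms(3) by blast
  \<comment> \<open>Right translation by \<open>u\<close> embeds the product set of \<open>T\<close>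
    into that of \<open>T + U\<close>, so without growth the image is everything. The result holds
    for every choice of \<open>u\<close>, which makes all orderings of \<open>U\<close>
    interchangeable after \<open>T\<close>.\<close>
  have "inj_on (\<lambda>t. t \<otimes> u) (products G T)"
    using products_closed[OF T] uc by (intro inj_onI) (metis right_cancel subsetD)
  then have "card ((\<lambda>t. t \<otimes> u) ` products G T) = card (products G T)" by (rule card_image)
  moreover have "(\<lambda>t. t \<otimes> u) ` products G T \<subseteq> products G (T + U)"
    using products_append[OF T assms(3) _ u] by auto
  moreover have "finite (products G (T + U))"
    using finite_subset[OF products_closed fin] T assms(3) by (auto simp: sequence_over_def)
  ultimately show ?thesis using card card_seteq by metis
qed

lemma exists_flexible_subsequence:
  assumes fin: "finite (carrier G)" and S: "product_one G S"
  obtains T where "T \<subseteq># S" "size T + 2 \<le> 2 * card (products G T)"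
    "\<And>rs. mset rs = S - T \<Longrightarrow> \<exists>t \<in> products G T. t \<otimes> list_product G rs = \<one>"
proof -
  define Q where "Q T rs \<longleftrightarrow> T + mset rs = S \<and> (\<exists>t \<in> products G T. t \<otimes> list_product G rs = \<one>)" for T rs
  \<comment> \<open>The empty prefix attains equality. Up to two new terms that add at least one
    product preserve the inequality, as its right side grows by at least 2.\<close>
  define valid where "valid T \<longleftrightarrow> size T + 2 \<le> 2 * card (products G T)" for T
  define A where "A = {T. valid T \<and> (\<exists>rs. Q T rs)}"
  have seq: "sequence_over G S" using S by (simp add: product_one_def)
  obtain ss where "mset ss = S" "list_product G ss = \<one>" using S by (auto simp: product_one_def)
  moreover have "products G {#} = {\<one>}" by (auto simp: products_def)
  ultimately have "{#} \<in> A" by (auto simp: A_def Q_def valid_def)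
  moreover have "\<forall>T. T \<in> A \<longrightarrow> size T < Suc (size S)"
    by (auto simp: A_def Q_def)
  ultimately obtain T where TA: "T \<in> A" and max: "\<And>T'. T' \<in> A \<Longrightarrow> size T' \<le> size T"
    using ex_has_greatest_nat[of "\<lambda>T. T \<in> A" "{#}" size "Suc (size S)"] by auto
  obtain rs0 where rs0: "Q T rs0" and T: "valid T" using TA by (auto simp: A_def)
  have enlarge: "card (products G (T + U)) \<le> card (products G T)"
    if "Q (T + U) rs" "U \<noteq> {#}" "size U \<le> 2" for U rs
  proof -
    have "\<not> valid (T + U)"
      using max[of "T + U"] that(1,2) by (auto simp: A_def)
    then show ?thesis using T that(3) by (simp add: valid_def)
  qed
  have seqT: "sequence_over G T"
    using seq rs0 by (auto simp: Q_def sequence_over_def)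
  have rs: "set rs \<subseteq> carrier G" if "Q T rs" for rs
    using seq that by (auto simp: Q_def sequence_over_def)
  have swap: "Q T (b # a # rs)" if Q: "Q T (a # b # rs)" for a b rs
  proof -
    let ?U = "{#a, b#}" and ?r = "list_product G rs"
    have c: "a \<in> carrier G" "b \<in> carrier G" "set rs \<subseteq> carrier G" using rs[OF Q] by auto
    have rc: "?r \<in> carrier G" using list_product_closed c by simp
    have U: "sequence_over G ?U" using c by (simp add: sequence_over_def)
    have ab: "a \<otimes> b \<in> products G ?U" "b \<otimes> a \<in> products G ?U"
      using products_append[of "{#a#}" "{#b#}" a b] products_append[of "{#b#}" "{#a#}" b a] c
      by (auto simp: products_single sequence_over_def add_mset_commute)
    obtain t where t: "t \<in> products G T" "t \<otimes> (a \<otimes> (b \<otimes> ?r)) = \<one>"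
      using Q by (auto simp: Q_def)
    have tc: "t \<in> carrier G" using t products_closed[OF seqT] by blast
    have mem: "t \<otimes> (a \<otimes> b) \<in> products G (T + ?U)"
      using products_append[OF seqT U t(1) ab(1)] .
    \<comment> \<open>Absorbing \<open>a\<close> and \<open>b\<close> into the prefix yields a
      candidate competing with \<open>T\<close>, so the product set cannot have grown. Translating
      by the other ordering \<open>b \<otimes> a\<close> then rewrites
      \<open>t \<otimes> (a \<otimes> b)\<close>.\<close>
    have "t \<otimes> (a \<otimes> b) \<otimes> ?r = \<one>" using t(2) tc c rc by (simp add: m_assoc)
    then have "Q (T + ?U) rs" using Q mem unfolding Q_def by auto
    then have "card (products G (T + ?U)) \<le> card (products G T)" by (rule enlarge) simp_all
    then obtain t' where t': "t' \<in> products G T" "t \<otimes> (a \<otimes> b) = t' \<otimes> (b \<otimes> a)"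
      using products_translate[OF fin seqT U ab(2)] mem by auto
    then have "t' \<in> carrier G" using products_closed[OF seqT] by blast
    then have "t' \<otimes> (b \<otimes> (a \<otimes> ?r)) = \<one>"
      using \<open>t \<otimes> (a \<otimes> b) \<otimes> ?r = \<one>\<close> t'(2) c rc by (simp add: m_assoc)
    then show ?thesis using Q t'(1) by (auto simp: Q_def add_mset_commute)
  qed
  have rot: "Q T (a # rs)" if Q: "Q T (rs @ [a])" for a rs
  proof -
    let ?r = "list_product G rs"
    have c: "a \<in> carrier G" "set rs \<subseteq> carrier G" using rs[OF Q] by auto
    have rc: "?r \<in> carrier G" using list_product_closed c by simp
    have U: "sequence_over G {#a#}" "a \<in> products G {#a#}"
      using c by (simp_all add: sequence_over_def products_single)
    obtain t where t: "t \<in> products G T" "t \<otimes> (?r \<otimes> a) = \<one>"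
      using Q c list_product_append[of rs "[a]"] by (auto simp: Q_def)
    have tc: "t \<in> carrier G" using t products_closed[OF seqT] by blast
    \<comment> \<open>A product set does not record on which side of \<open>T\<close> the term
      \<open>a\<close> was placed, so \<open>a \<otimes> t\<close> must also arise by translating on
      the right by \<open>a\<close>.\<close>
    have mem: "a \<otimes> t \<in> products G (T + {#a#})"
      using products_append[OF U(1) seqT U(2) t(1)] by simp
    have "(t \<otimes> ?r) \<otimes> a = \<one>" using t(2) tc c rc by (simp add: m_assoc)
    then have "a \<otimes> (t \<otimes> ?r) = \<one>" using inv_comm tc c rc by blast
    then have one: "a \<otimes> t \<otimes> ?r = \<one>" using tc c rc by (simp add: m_assoc)
    then have "Q (T + {#a#}) rs" using Q mem unfolding Q_def by auto
    then have "card (products G (T + {#a#})) \<le> card (products G T)" by (rule enlarge) simp_all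
    then obtain t' where t': "t' \<in> products G T" "a \<otimes> t = t' \<otimes> a"
      using products_translate[OF fin seqT U] mem by auto
    then have "t' \<in> carrier G" using products_closed[OF seqT] by blast
    then have "t' \<otimes> (a \<otimes> ?r) = \<one>" using one t'(2) c rc by (simp add: m_assoc)
    then show ?thesis using Q t'(1) by (auto simp: Q_def)
  qed
  show thesis
  proof
    show "T \<subseteq># S" using rs0 by (auto simp: Q_def)
    show "size T + 2 \<le> 2 * card (products G T)" using T by (simp add: valid_def)
    fix rs assume "mset rs = S - T"
    then have "mset rs0 = mset rs" using rs0 by (auto simp: Q_def)
    then have "Q T rs" using perm_closed_by_swap_rotate[of "Q T", OF swap rot rs0] by blast
    then show "\<exists>t \<in> products G T. t \<otimes> list_product G rs = \<one>" by (simp add: Q_def)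
  qed
qed

section \<open>The upper bound\<close>

lemma product_one_subsequence_if_gt_small_davenport:
  assumes "finite (carrier G)" "sequence_over G R" "small_davenport G < size R"
  obtains W where "W \<subseteq># R" "W \<noteq> {#}" "product_one G W"
proof -
  have "\<not> product_one_free G R"
    using Max_ge[OF davenport_well_defined(1)[OF assms(1)], of "size R"] assms(3)
    by (auto simp: small_davenport_def)
  then show thesis using assms(2) that by (auto simp: product_one_free_def)
qed

text \<open>The maximum with 1 matters for a trivial commutator subgroup, where the other term is 0
  although atoms of length \<open>small_davenport G + 1\<close> exist.\<close>

lemma minimal_product_one_size_le:
  assumes fin: "finite (carrier G)" and S: "minimal_product_one G S"
  shows "size S \<le> small_davenport G + max 1 (2 * card (derived G (carrier G)) - 2)"
proof (rule ccontr)
  assume large: "\<not> ?thesis"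
  have one: "product_one G S" using S by (simp add: minimal_product_one_def)
  then have seq: "sequence_over G S" by (simp add: product_one_def)
  obtain T where T: "T \<subseteq># S" "size T + 2 \<le> 2 * card (products G T)"
    and flex: "\<And>rs. mset rs = S - T \<Longrightarrow> \<exists>t \<in> products G T. t \<otimes> list_product G rs = \<one>"
    using exists_flexible_subsequence[OF fin one] by blast
  have seqT: "sequence_over G T" using T(1) seq by (auto simp: sequence_over_def dest: mset_subset_eqD)
  have "size T \<le> 2 * card (derived G (carrier G)) - 2"
    using card_products_le_derived[OF fin seqT] T(2) by simp
  then have big: "small_davenport G < size (S - T)"
    using large size_Diff_submset[OF T(1)] by simp
  \<comment> \<open>Cutting down to exactly \<open>small_davenport G + 1\<close> terms makes
    \<open>R\<close> shorter than \<open>S\<close>, by the 1 inside the maximum. So the product-one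
    part \<open>W\<close> of \<open>R\<close> cannot exhaust \<open>S\<close>, even when
    \<open>T\<close> is empty.\<close>
  then obtain R rest where R: "S - T = R + rest" "size R = Suc (small_davenport G)"
  proof -
    obtain xs where xs: "mset xs = S - T" by (metis ex_mset)
    let ?k = "Suc (small_davenport G)"
    have "S - T = mset (take ?k xs) + mset (drop ?k xs)"
      using xs by (metis append_take_drop_id mset_append)
    moreover have "size (mset (take ?k xs)) = ?k" using big xs by (metis Suc_leI length_take min.absorb2 size_mset)
    ultimately show thesis using that by blast
  qed
  have S_eq: "S = T + (R + rest)" using T(1) R(1) by (metis subset_mset.add_diff_inverse)
  have "sequence_over G R" using seq S_eq by (simp add: sequence_over_def)
  then obtain W where W: "W \<subseteq># R" "W \<noteq> {#}" "product_one G W"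
    using product_one_subsequence_if_gt_small_davenport[OF fin] R(2) by (metis lessI)
  then obtain V where V: "R + rest = W + V" by (metis mset_subset_eq_add_left subset_mset.le_iff_add subset_mset.trans)
  have S_split: "S = W + (T + V)" using S_eq V by (simp add: add_ac)
  have seqV: "sequence_over G V" "sequence_over G (T + V)" using seq S_split by (auto simp: sequence_over_def)
  obtain ws vs where ws: "mset ws = W" "list_product G ws = \<one>" and vs: "mset vs = V"
    using W(3) by (metis ex_mset product_one_def)
  have c: "set ws \<subseteq> carrier G" "set vs \<subseteq> carrier G"
    using seq S_split ws(1) vs by (auto simp: sequence_over_def)
  \<comment> \<open>The free order of the remaining terms allows \<open>W\<close> to come first, in
    an ordering with product 1, so that it cancels.\<close>
  obtain t where t: "t \<in> products G T" "t \<otimes> list_product G (ws @ vs) = \<one>"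
    using flex[of "ws @ vs"] ws(1) vs R(1) V by auto
  have "t \<otimes> list_product G vs = \<one>"
    using t(2) list_product_append[OF c] ws(2) list_product_closed[OF c(2)] by simp
  moreover have "t \<otimes> list_product G vs \<in> products G (T + V)"
    using products_append[OF seqT seqV(1) t(1)] vs by (auto simp: products_def)
  ultimately have "product_one G (T + V)"
    using seqV(2) by (simp add: product_one_iff_products)
  moreover have "T + V \<noteq> {#}"
  proof
    assume "T + V = {#}"
    then have "size S \<le> size R" using S_split W(1) size_mset_mono by force
    then show False using large R(2) by simp
  qed
  ultimately show False using S S_split W(2,3) unfolding minimal_product_one_def by blast
qed

lemma large_davenport_le:
  assumes "finite (carrier G)"
  shows "large_davenport G \<le> small_davenport G + max 1 (2 * card (derived G (carrier G)) - 2)"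
proof -
  have "large_davenport G \<in> {size S | S. minimal_product_one G S}"
    unfolding large_davenport_def by (intro Max_in davenport_well_defined assms)
  then show ?thesis using minimal_product_one_size_le[OF assms] by auto
qed

section \<open>The lower bound and the case of equality\<close>

lemma small_davenport_less_large_davenport:
  assumes "finite (carrier G)"
  shows "small_davenport G < large_davenport G"
proof -
  have "small_davenport G \<in> {size S | S. product_one_free G S}"
    unfolding small_davenport_def by (intro Max_in davenport_well_defined assms)
  then obtain S where S: "small_davenport G = size S" "product_one_free G S" by auto
  obtain xs where xs: "mset xs = S" by (metis ex_mset)
  have c: "set xs \<subseteq> carrier G"
    using S(2) xs by (auto simp: product_one_free_def sequence_over_def)
  \<comment> \<open>Adjoining the inverse of its product turns a longest product-one free sequence
    into an atom: in any splitting, one part contains a copy of \<open>?g\<close>, and the other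
    part then lies inside \<open>S\<close>.\<close>
  let ?g = "inv (list_product G xs)"
  have g: "list_product G xs \<in> carrier G" using list_product_closed[OF c] .
  have "list_product G (?g # xs) = \<one>" using g by simp
  moreover have "mset (?g # xs) = add_mset ?g S" using xs by simp
  moreover have "sequence_over G (add_mset ?g S)"
    using g c xs by (auto simp: sequence_over_def)
  ultimately have one: "product_one G (add_mset ?g S)"
    unfolding product_one_def by blast
  have no: False if B: "product_one G B" "B \<noteq> {#}" "add_mset ?g S = A + B" "?g \<in># A" for A B
  proof -
    obtain A' where "A = add_mset ?g A'" using B(4) by (metis multi_member_split)
    then have "B \<subseteq># S" using B(3) by simp
    then show False using S(2) B(1,2) by (auto simp: product_one_free_def)
  qed
  have "minimal_product_one G (add_mset ?g S)"
    unfolding minimal_product_one_def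
  proof (intro conjI one notI; (elim exE conjE)?)
    fix A B assume AB: "add_mset ?g S = A + B" "A \<noteq> {#}" "B \<noteq> {#}" "product_one G A" "product_one G B"
    then have "?g \<in># A \<or> ?g \<in># B" by (metis union_iff union_single_eq_member)
    then show False using no[of B A] no[of A B] AB by (auto simp: add.commute)
  qed simp
  then have "Suc (size S) \<in> {size S | S. minimal_product_one G S}" by force
  then have "Suc (size S) \<le> large_davenport G"
    unfolding large_davenport_def by (intro Max_ge davenport_well_defined assms)
  then show ?thesis using S(1) by simp
qed

lemma card_derived_eq_1_iff:
  "card (derived G (carrier G)) = 1 \<longleftrightarrow> comm_group G"
proof
  have H: "subgroup (derived G (carrier G)) G" using derived_is_subgroup[of "carrier G"] by simp
  assume "card (derived G (carrier G)) = 1"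
  then have D: "derived G (carrier G) = {\<one>}"
    using subgroup.one_closed[OF H] by (auto simp: card_1_singleton_iff)
  show "comm_group G"
  proof (rule group_comm_groupI)
    fix x y assume "x \<in> carrier G" "y \<in> carrier G"
    then show "x \<otimes> y = y \<otimes> x"
      using derived_rcos_commute[of x y] D by (simp add: r_coset_def)
  qed
next
  assume "comm_group G"
  then interpret comm_group G .
  have "derived G (carrier G) = {\<one>}" using derived_eq_singleton[of "carrier G"] by simp
  then show "card (derived G (carrier G)) = 1" by simp
qed

end

theorem theorem3p1:
  fixes G :: "('a, 'b) monoid_scheme"
  assumes "group G" and "finite (carrier G)"
  shows "large_davenport G \<le> small_davenport G + 2 * card (derived G (carrier G)) - 1 \<and>
    (large_davenport G = small_davenport G + 2 * card (derived G (carrier G)) - 1 \<longleftrightarrow> comm_group G)"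
proof -
  interpret group G by fact
  have H: "subgroup (derived G (carrier G)) G" using derived_is_subgroup[of "carrier G"] by simp
  have "finite (derived G (carrier G))" "derived G (carrier G) \<noteq> {}"
    using finite_subset[OF subgroup.subset[OF H] assms(2)] subgroup.one_closed[OF H] by auto
  then have "card (derived G (carrier G)) \<ge> 1" by (simp add: Suc_leI card_gt_0_iff)
  \<comment> \<open>If the commutator subgroup has order 1, both bounds give
    \<open>small_davenport G + 1\<close>, which is equality. Otherwise the maximum is
    \<open>2 * card (derived G (carrier G)) - 2\<close>, one less than the stated bound, so the
    inequality is strict.\<close>
  then show ?thesis
    using large_davenport_le[OF assms(2)] small_davenport_less_large_davenport[OF assms(2)]
      card_derived_eq_1_iff
    by (cases "card (derived G (carrier G)) = 1") (auto simp: max_def split: if_splits)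
qed

end
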